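(* Let $\beta>1$, let $0\le t\le 1-\frac1\beta$, and write $\overline{d}_\beta(t)=as$ with $a\in A_\beta$ and $s\in A_\beta^{\mathbb{N}}$; put $b=a+1$ and $I=[t,t+\frac1\beta]$. (a) If $s\le a^\omega$, then $I$ contains the $\overline{T}_\beta$-orbit closure of $(a^\omega)_\beta$, which is invariant, is the unique invariant $\overline{T}_\beta$-orbit closure contained in $I$, and has frequency $a$. (b) If $s\ge b^\omega$, then $I$ contains the $\overline{T}_\beta$-orbit closure of $(b^\omega)_\beta$, which is invariant, is the unique invariant $\overline{T}_\beta$-orbit closure contained in $I$, and has frequency $b$. (c) If $as=s_{\alpha,0}$ or $bs=s'_{\alpha,0}$ for some $\alpha\in[a,b]$, then $I$ contains the $\overline{T}_\beta$-orbit closure of $(s'_{\alpha,0})_\beta$, which is invariant, is the unique invariant $\overline{T}_\beta$-orbit closure contained in $I$, and has frequency $\alpha$.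
   Context: For $\beta>1$ let $A_\beta=\{0,1,\dots,\lceil\beta\rceil-1\}$. Infinite words over nonnegative integers are compared lexicographically. For a word $w=w_1w_2\cdots$ of nonnegative integers, $(w)_\beta=\sum_{i\ge1}w_i\beta^{-i}$; $v^\omega=vvv\cdots$. Define $\langle t\rangle=\{t\}$ (fractional part) if $t\notin\mathbb{Z}$ and $\langle t\rangle=1$ if $t\in\mathbb{Z}$. The $\overline{\beta}$-transformation $\overline{T}_\beta:[0,1]\to(0,1]$ is $\overline{T}_\beta(x)=\langle\beta x\rangle$ and the $\overline{\beta}$-expansion of $x\in[0,1]$ is $\overline{d}_\beta(x)=(x_i)_{i\ge1}$ with $x_i=\lceil\beta\overline{T}_\beta^{i-1}(x)\rceil-1$. A $\overline{T}_\beta$-orbit closure is the closure of $\{\overline{T}_\beta^n(x):n\ge0\}$; it is invariant if $\overline{T}_\beta(S)=S$. The frequency of $x$ is $\lim_{n\to\infty}\frac1n\sum_{k=1}^na_k$ where $\overline{d}_\beta(x)=a_1a_2\cdots$; a set has frequency $\alpha$ if all its elements have frequency $\alpha$. For real $\alpha\ge0$, $s_{\alpha,0}$ and $s'_{\alpha,0}$ are the infinite words with $n$-th letters ($n\ge0$) $\lfloor\alpha(n+1)\rfloor-\lfloor\alpha n\rfloor$ and $\lceil\alpha(n+1)\rceil-\lceil\alpha n\rceil$ respectively (lower and upper mechanical words of slope $\alpha$ and intercept $0$). *)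

theory Defs
  imports Complex_Main "HOL-Analysis.Analysis" "HOL-Library.Fun_Lexorder"
begin

text \<open>
  Infinite words are functions \<open>nat \<Rightarrow> int\<close>, indexed from 0; the word \<open>a s\<close> is \<open>case_nat a s\<close>
  and \<open>a\<^sup>\<omega>\<close> is the constant function. Letters are integers rather than naturals because the
  digit formula \<open>\<lceil>\<beta> * x\<rceil> - 1\<close> yields \<open>-1\<close> at \<open>x = 0\<close>, which truncated subtraction would
  silently turn into the admissible digit \<open>0\<close>.
\<close>

definition alphabet :: "real \<Rightarrow> int set" where
  "alphabet \<beta> = {0..\<lceil>\<beta>\<rceil> - 1}"

definition lex_le :: "(nat \<Rightarrow> int) \<Rightarrow> (nat \<Rightarrow> int) \<Rightarrow> bool" where
  "lex_le u v \<longleftrightarrow> u = v \<or> less_fun u v"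

definition word_value :: "real \<Rightarrow> (nat \<Rightarrow> int) \<Rightarrow> real" where
  "word_value \<beta> w = (\<Sum>i. of_int (w i) / \<beta> ^ Suc i)"

definition upper_frac :: "real \<Rightarrow> real" where
  "upper_frac x = (if x \<in> \<int> then 1 else frac x)"

definition Tbar :: "real \<Rightarrow> real \<Rightarrow> real" where
  "Tbar \<beta> x = upper_frac (\<beta> * x)"

definition dbar :: "real \<Rightarrow> real \<Rightarrow> nat \<Rightarrow> int" where
  "dbar \<beta> x i = \<lceil>\<beta> * (Tbar \<beta> ^^ i) x\<rceil> - 1"

definition orbit_closure :: "real \<Rightarrow> real \<Rightarrow> real set" where
  "orbit_closure \<beta> x = closure (range (\<lambda>n. (Tbar \<beta> ^^ n) x))"

definition is_orbit_closure :: "real \<Rightarrow> real set \<Rightarrow> bool" where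
  "is_orbit_closure \<beta> S \<longleftrightarrow> (\<exists>x\<in>{0..1}. S = orbit_closure \<beta> x)"

definition Tbar_invariant :: "real \<Rightarrow> real set \<Rightarrow> bool" where
  "Tbar_invariant \<beta> S \<longleftrightarrow> Tbar \<beta> ` S = S"

definition has_frequency :: "real \<Rightarrow> real \<Rightarrow> real \<Rightarrow> bool" where
  "has_frequency \<beta> x \<alpha> \<longleftrightarrow>
     (\<lambda>n. 1 / real n * (\<Sum>k<n. real_of_int (dbar \<beta> x k))) \<longlonglongrightarrow> \<alpha>"

definition set_has_frequency :: "real \<Rightarrow> real set \<Rightarrow> real \<Rightarrow> bool" where
  "set_has_frequency \<beta> S \<alpha> \<longleftrightarrow> (\<forall>x\<in>S. has_frequency \<beta> x \<alpha>)"

definition lower_mechanical :: "real \<Rightarrow> nat \<Rightarrow> int" where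
  "lower_mechanical \<alpha> n = \<lfloor>\<alpha> * (real n + 1)\<rfloor> - \<lfloor>\<alpha> * real n\<rfloor>"

definition upper_mechanical :: "real \<Rightarrow> nat \<Rightarrow> int" where
  "upper_mechanical \<alpha> n = \<lceil>\<alpha> * (real n + 1)\<rceil> - \<lceil>\<alpha> * real n\<rceil>"

definition unique_invariant_orbit_closure_in :: "real \<Rightarrow> real set \<Rightarrow> real set \<Rightarrow> bool" where
  "unique_invariant_orbit_closure_in \<beta> J S \<longleftrightarrow>
     (\<forall>S'. is_orbit_closure \<beta> S' \<and> Tbar_invariant \<beta> S' \<and> S' \<subseteq> J \<longleftrightarrow> S' = S)"

end

theory Submission
  imports Defs
begin

text \<open>
  Call a point staying if its whole orbit lies in \<open>J = [t, t + 1/\<beta>]\<close>. On such points the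
  map behaves like a monotone circle map of degree one: if \<open>x \<le> y\<close> both stay, the digit sums of
  \<open>y\<close> of any length exceed those of \<open>x\<close> by \<open>0\<close> or \<open>1\<close>. Hence all staying points have the same
  frequency \<open>\<alpha>\<close>. The generator of an invariant orbit closure in \<open>J\<close> is recurrent, which forces the
  digit sums of length \<open>n\<close> to equal \<open>\<alpha> n\<close> whenever this is an integer; averaging along the orbit then
  shows that the maximum of the closure has digit sums \<open>\<lceil>\<alpha> n\<rceil>\<close>, so its expansion is the
  upper mechanical word of slope \<open>\<alpha>\<close>. The closure is the orbit closure of this point: for rational
  \<open>\<alpha>\<close> it is a periodic orbit, for irrational \<open>\<alpha>\<close> every prefix occurs in the mechanical word by
  Kronecker's theorem. Cases (a) and (b) are the integer slopes \<open>\<alpha> = a\<close> and \<open>\<alpha> = b\<close>.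
\<close>

section \<open>Digits and the order of expansions\<close>

text \<open>Both branches subtract the largest integer strictly below \<open>z\<close>. The digit
  \<open>\<lceil>\<beta> * x\<rceil> - 1\<close> and \<open>Tbar \<beta> x\<close> thus add up to
  \<open>\<beta> * x\<close>, with remainder in the half-open interval from 0 (excluded) to
  1.\<close>

lemma upper_frac_eq: "upper_frac z = z - of_int (\<lceil>z\<rceil> - 1)"
  by (auto simp: upper_frac_def frac_def ceiling_altdef elim!: Ints_cases) (metis Ints_of_int)

lemma Tbar_eq: "Tbar \<beta> x = \<beta> * x - of_int (dbar \<beta> x 0)"
  by (simp add: Tbar_def dbar_def upper_frac_eq)

lemma Tbar_pos: "0 < Tbar \<beta> x" and Tbar_le_1: "Tbar \<beta> x \<le> 1"
  using ceiling_correct[of "\<beta> * x"] by (simp_all add: Tbar_def upper_frac_eq)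

lemma funpow_Tbar_range:
  assumes "0 < x" "x \<le> 1"
  shows "0 < (Tbar \<beta> ^^ n) x" "(Tbar \<beta> ^^ n) x \<le> 1"
  using assms by (cases n; simp add: Tbar_pos Tbar_le_1)+

lemma dbar_funpow: "dbar \<beta> ((Tbar \<beta> ^^ m) x) n = dbar \<beta> x (m + n)"
  by (simp add: dbar_def add.commute flip: comp_apply[of "Tbar \<beta> ^^ n"] funpow_add)

lemma dbar_Suc: "dbar \<beta> x (Suc n) = dbar \<beta> (Tbar \<beta> x) n"
  using dbar_funpow[of \<beta> 1 x n] by simp

text \<open>Digit sums, not single digits, are compared: they act as the integer part of a lifted
  orbit, and bounds on them give back lexicographic bounds through
  \<open>lex_le_of_partial_sums\<close>.\<close>

definition digit_sum :: "real \<Rightarrow> real \<Rightarrow> nat \<Rightarrow> int" where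
  "digit_sum \<beta> x n = (\<Sum>k<n. dbar \<beta> x k)"

lemma digit_sum_0 [simp]: "digit_sum \<beta> x 0 = 0"
  by (simp add: digit_sum_def)

lemma digit_sum_Suc: "digit_sum \<beta> x (Suc n) = digit_sum \<beta> x n + dbar \<beta> x n"
  by (simp add: digit_sum_def)

lemma digit_sum_add:
  "digit_sum \<beta> x (m + n) = digit_sum \<beta> x m + digit_sum \<beta> ((Tbar \<beta> ^^ m) x) n"
  by (induction n) (simp_all add: digit_sum_Suc dbar_funpow)

lemma digit_sum_blocks:
  "digit_sum \<beta> x (k * n) = (\<Sum>j<k. digit_sum \<beta> ((Tbar \<beta> ^^ (j * n)) x) n)"
proof (induction k)
  case (Suc k)
  then show ?case
    using digit_sum_add[of \<beta> x "k * n" n] by (simp add: add.commute)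
qed simp

lemma digit_sum_cong:
  "(\<And>i. i < n \<Longrightarrow> dbar \<beta> x i = dbar \<beta> y i) \<Longrightarrow> digit_sum \<beta> x n = digit_sum \<beta> y n"
  by (simp add: digit_sum_def)

lemma dbar_eq_of_digit_sum:
  assumes "\<And>n. n \<le> N \<Longrightarrow> digit_sum \<beta> x n = digit_sum \<beta> y n" "i < N"
  shows "dbar \<beta> x i = dbar \<beta> y i"
  using assms(1)[of i] assms(1)[of "Suc i"] assms(2) by (simp add: digit_sum_Suc)

lemma dbar_expand:
  assumes "\<beta> > 1"
  shows "x = (\<Sum>i<N. of_int (dbar \<beta> x i) / \<beta> ^ Suc i) + (Tbar \<beta> ^^ N) x / \<beta> ^ N"
proof (induction N)
  case (Suc N)
  have "(Tbar \<beta> ^^ Suc N) x = \<beta> * (Tbar \<beta> ^^ N) x - of_int (dbar \<beta> x N)"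
    using dbar_funpow[of \<beta> N x 0] by (simp add: Tbar_eq)
  then show ?case
    using assms Suc by (simp add: field_simps)
qed simp

lemma diff_of_common_prefix:
  assumes "\<beta> > 1" "\<And>i. i < N \<Longrightarrow> dbar \<beta> x i = dbar \<beta> y i"
  shows "x - y = ((Tbar \<beta> ^^ N) x - (Tbar \<beta> ^^ N) y) / \<beta> ^ N"
proof -
  have "(\<Sum>i<N. of_int (dbar \<beta> x i) / \<beta> ^ Suc i) = (\<Sum>i<N. of_int (dbar \<beta> y i) / \<beta> ^ Suc i)"
    using assms(2) by (intro sum.cong) auto
  then show ?thesis
    using dbar_expand[OF assms(1), of x N] dbar_expand[OF assms(1), of y N]
    by (simp add: diff_divide_distrib)
qed

lemma dist_le_of_common_prefix:
  assumes "\<beta> > 1" "\<And>i. i < N \<Longrightarrow> dbar \<beta> x i = dbar \<beta> y i"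
    and "0 < x" "x \<le> 1" "0 < y" "y \<le> 1"
  shows "\<bar>x - y\<bar> \<le> (1 / \<beta>) ^ N"
proof -
  have "\<bar>(Tbar \<beta> ^^ N) x - (Tbar \<beta> ^^ N) y\<bar> \<le> 1"
    using funpow_Tbar_range[of x N \<beta>] funpow_Tbar_range[of y N \<beta>] assms by linarith
  moreover have "\<bar>x - y\<bar> = \<bar>(Tbar \<beta> ^^ N) x - (Tbar \<beta> ^^ N) y\<bar> / \<beta> ^ N"
    using diff_of_common_prefix[OF assms(1,2), of N] assms(1) by simp
  ultimately show ?thesis
    using assms(1) by (simp add: power_one_over divide_right_mono)
qed

lemma ex_inverse_power_less:
  fixes \<beta> e :: real
  assumes "\<beta> > 1" "e > 0"
  obtains N where "(1 / \<beta>) ^ N < e"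
  using real_arch_pow_inv[of e "1 / \<beta>"] assms by auto

lemma dbar_inj:
  assumes "\<beta> > 1" "dbar \<beta> x = dbar \<beta> y" "0 < x" "x \<le> 1" "0 < y" "y \<le> 1"
  shows "x = y"
proof (rule ccontr)
  assume "x \<noteq> y"
  then obtain N where "(1 / \<beta>) ^ N < \<bar>x - y\<bar>"
    using ex_inverse_power_less[OF assms(1), of "\<bar>x - y\<bar>"] by auto
  then show False
    using dist_le_of_common_prefix[of \<beta> N x y] assms by simp
qed

text \<open>Digits increase weakly with the point, so the iterates at the first difference are
  strictly ordered; the common prefix only divides their difference by a power of \<beta>.\<close>

lemma dbar_less_imp_less:
  assumes "\<beta> > 1" "less_fun (dbar \<beta> x) (dbar \<beta> y)"
  shows "x < y"
proof -
  obtain k where k: "dbar \<beta> x k < dbar \<beta> y k" "\<And>i. i < k \<Longrightarrow> dbar \<beta> x i = dbar \<beta> y i"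
    using assms(2) by (auto simp: less_fun_def)
  have "(Tbar \<beta> ^^ k) x < (Tbar \<beta> ^^ k) y"
  proof (rule ccontr)
    assume "\<not> ?thesis"
    then have "\<lceil>\<beta> * (Tbar \<beta> ^^ k) y\<rceil> \<le> \<lceil>\<beta> * (Tbar \<beta> ^^ k) x\<rceil>"
      using assms(1) by (intro ceiling_mono mult_left_mono) auto
    then show False
      using k(1) by (simp add: dbar_def)
  qed
  then show ?thesis
    using diff_of_common_prefix[OF assms(1) k(2), of k] assms(1)
    by (smt (verit) divide_neg_pos zero_less_power)
qed

lemma dbar_le_imp_le:
  assumes "\<beta> > 1" "lex_le (dbar \<beta> x) (dbar \<beta> y)" "0 < x" "x \<le> 1" "0 < y" "y \<le> 1"
  shows "x \<le> y"
  using assms dbar_inj[of \<beta> x y] dbar_less_imp_less[of \<beta> x y]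
  by (auto simp: lex_le_def)

lemma word_value_dbar:
  assumes "\<beta> > 1" "0 < x" "x \<le> 1"
  shows "word_value \<beta> (dbar \<beta> x) = x"
proof -
  let ?r = "\<lambda>N. (Tbar \<beta> ^^ N) x / \<beta> ^ N"
  have "?r \<longlonglongrightarrow> 0"
  proof (rule Lim_null_comparison)
    show "(\<lambda>N. (1 / \<beta>) ^ N) \<longlonglongrightarrow> 0"
      using assms(1) by (intro LIMSEQ_realpow_zero) auto
    show "\<forall>\<^sub>F N in sequentially. norm (?r N) \<le> (1 / \<beta>) ^ N"
      using funpow_Tbar_range[of x _ \<beta>] assms
      by (intro always_eventually) (simp add: power_one_over divide_right_mono abs_of_pos)
  qed
  then have "(\<lambda>N. x - ?r N) \<longlonglongrightarrow> x - 0"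
    by (intro tendsto_intros)
  moreover have "x - ?r N = (\<Sum>i<N. of_int (dbar \<beta> x i) / \<beta> ^ Suc i)" for N
    using dbar_expand[OF assms(1), of x N] by linarith
  ultimately have "(\<lambda>i. of_int (dbar \<beta> x i) / \<beta> ^ Suc i) sums x"
    by (simp add: sums_def)
  then show ?thesis
    by (simp add: word_value_def sums_iff)
qed

text \<open>The partial sums agree up to the first difference, so the next partial sum compares the
  differing letters themselves.\<close>

lemma lex_le_of_partial_sums:
  assumes "\<And>n. (\<Sum>i<n. u i) \<le> (\<Sum>i<n. v i)"
  shows "lex_le u v"
proof (cases "u = v")
  case False
  define k where "k = (LEAST k. u k \<noteq> v k)"
  from False have "\<exists>k. u k \<noteq> v k" by auto
  then have k: "u k \<noteq> v k" "\<And>i. i < k \<Longrightarrow> u i = v i"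
    unfolding k_def using LeastI_ex[of "\<lambda>k. u k \<noteq> v k"] not_less_Least by blast+
  have "(\<Sum>i<k. u i) = (\<Sum>i<k. v i)"
    using k(2) by (intro sum.cong) auto
  then have "u k < v k"
    using assms[of "Suc k"] k(1) by simp
  then show ?thesis
    using k(2) by (auto simp: lex_le_def less_fun_def)
qed (simp add: lex_le_def)

lemma orbit_mem: "(Tbar \<beta> ^^ n) x \<in> orbit_closure \<beta> x"
  unfolding orbit_closure_def by (rule subsetD[OF closure_subset]) simp

section \<open>Points whose orbit stays in a window of length \<open>1 / \<beta>\<close>\<close>

locale beta_window =
  fixes \<beta> t :: real and a :: int
  assumes beta: "\<beta> > 1" and t_pos: "0 < t" and t_le: "t + 1 / \<beta> \<le> 1"
    and a_def: "a = \<lceil>\<beta> * t\<rceil> - 1"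
begin

abbreviation "J \<equiv> {t..t + 1 / \<beta>}"

definition stays :: "real \<Rightarrow> bool" where
  "stays x \<longleftrightarrow> (\<forall>n. (Tbar \<beta> ^^ n) x \<in> J)"

lemma J_unit: "x \<in> J \<Longrightarrow> 0 < x" "x \<in> J \<Longrightarrow> x \<le> 1"
  using t_pos t_le by auto

lemma stays_J: "stays x \<Longrightarrow> x \<in> J"
  unfolding stays_def by (metis funpow_0)

lemma stays_unit: "stays x \<Longrightarrow> 0 < x" "stays x \<Longrightarrow> x \<le> 1"
  using stays_J J_unit by blast+

lemma stays_funpow: "stays x \<Longrightarrow> stays ((Tbar \<beta> ^^ n) x)"
  unfolding stays_def by (metis comp_apply funpow_add)

lemma stays_Tbar: "stays x \<Longrightarrow> stays (Tbar \<beta> x)"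
  using stays_funpow[of x 1] by simp

text \<open>Multiplication by \<beta> stretches \<open>J\<close> to length one, starting above
  \<open>a\<close> and at most at \<open>a + 1\<close>; hence only one integer can separate two
  digits.\<close>

lemma digit_window:
  assumes "x \<in> J"
  shows "dbar \<beta> x 0 = (if \<beta> * x \<le> of_int (a + 1) then a else a + 1)"
proof -
  have 1: "\<beta> * t \<le> \<beta> * x" "\<beta> * x \<le> \<beta> * t + 1"
    using assms beta by (auto simp: field_simps)
  have 2: "of_int a < \<beta> * t" "\<beta> * t \<le> of_int (a + 1)"
    using ceiling_correct[of "\<beta> * t"] by (auto simp: a_def)
  show ?thesis
  proof (cases "\<beta> * x \<le> of_int (a + 1)")
    case True
    then have "\<lceil>\<beta> * x\<rceil> = a + 1"
      using 1 2 by (intro ceiling_unique) auto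
    then show ?thesis using True by (simp add: dbar_def)
  next
    case False
    then have "\<lceil>\<beta> * x\<rceil> = a + 2"
      using 1 2 by (intro ceiling_unique) auto
    then show ?thesis using False by (simp add: dbar_def)
  qed
qed

text \<open>As \<open>\<beta> * y - \<beta> * x\<close> lies between 0 and 1, subtracting equal
  digits keeps the order, while subtracting one more from \<open>y\<close> reverses it.\<close>

lemma Tbar_window_diff:
  assumes "x \<in> J" "y \<in> J" "x \<le> y"
  shows "dbar \<beta> x 0 = dbar \<beta> y 0 \<and> Tbar \<beta> x \<le> Tbar \<beta> y \<or>
         dbar \<beta> y 0 = dbar \<beta> x 0 + 1 \<and> Tbar \<beta> y \<le> Tbar \<beta> x"
proof -
  have "\<beta> * t \<le> \<beta> * x" "\<beta> * x \<le> \<beta> * y" "\<beta> * y \<le> \<beta> * t + 1"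
    using assms beta by (auto simp: field_simps)
  then show ?thesis
    using digit_window[OF assms(1)] digit_window[OF assms(2)] by (auto simp: Tbar_eq)
qed

text \<open>In terms of the circle map, the two alternatives say that the lifts of the two orbits stay ordered and at distance at most one.\<close>
lemma digit_sum_order:
  assumes "stays x" "stays y" "x \<le> y"
  shows "digit_sum \<beta> y n = digit_sum \<beta> x n \<and> (Tbar \<beta> ^^ n) x \<le> (Tbar \<beta> ^^ n) y \<or>
         digit_sum \<beta> y n = digit_sum \<beta> x n + 1 \<and> (Tbar \<beta> ^^ n) y \<le> (Tbar \<beta> ^^ n) x"
proof (induction n)
  case (Suc n)
  have J: "(Tbar \<beta> ^^ n) x \<in> J" "(Tbar \<beta> ^^ n) y \<in> J"
    using assms by (auto simp: stays_def)
  have "(Tbar \<beta> ^^ n) x \<le> (Tbar \<beta> ^^ n) y \<longrightarrow> ?case \<or> digit_sum \<beta> y n \<noteq> digit_sum \<beta> x n"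
    using Tbar_window_diff[OF J] by (auto simp: digit_sum_Suc dbar_funpow)
  moreover have "(Tbar \<beta> ^^ n) y \<le> (Tbar \<beta> ^^ n) x \<longrightarrow>
      ?case \<or> digit_sum \<beta> y n \<noteq> digit_sum \<beta> x n + 1"
    using Tbar_window_diff[OF J(2,1)] by (auto simp: digit_sum_Suc dbar_funpow)
  ultimately show ?case using Suc by auto
qed (use assms in simp)

lemma digit_sum_mono:
  "stays x \<Longrightarrow> stays y \<Longrightarrow> x \<le> y \<Longrightarrow> digit_sum \<beta> x n \<le> digit_sum \<beta> y n"
  using digit_sum_order[of x y n] by auto

lemma digit_sum_diff:
  "stays x \<Longrightarrow> stays y \<Longrightarrow> \<bar>digit_sum \<beta> x n - digit_sum \<beta> y n\<bar> \<le> 1"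
  using digit_sum_order[of x y n] digit_sum_order[of y x n] by (cases "x \<le> y") auto

text \<open>A staying point right of the discontinuity \<open>(a + 1) / \<beta>\<close> has distance at least
  \<open>t / \<beta>\<close> from it, because its image is at least \<open>t\<close>.\<close>
lemma digit_locally_constant:
  assumes "x \<in> J" "stays y" "\<bar>x - y\<bar> < t / \<beta>"
    and "\<beta> * x > of_int (a + 1) \<Longrightarrow> \<beta> * \<bar>x - y\<bar> < \<beta> * x - of_int (a + 1)"
  shows "dbar \<beta> x 0 = dbar \<beta> y 0"
proof -
  have "t \<le> Tbar \<beta> y"
    using assms(2) stays_Tbar stays_J by fastforce
  then have *: "\<beta> * y > of_int (a + 1) \<Longrightarrow> \<beta> * y \<ge> of_int (a + 1) + t"
    using digit_window[OF stays_J[OF assms(2)]] by (simp add: Tbar_eq)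
  have "\<bar>\<beta> * x - \<beta> * y\<bar> = \<beta> * \<bar>x - y\<bar>"
    using beta by (simp add: abs_mult flip: right_diff_distrib)
  moreover have "\<beta> * \<bar>x - y\<bar> < t"
    using assms(3) beta by (simp add: field_simps)
  ultimately show ?thesis
    using * assms(4) digit_window[OF stays_J[OF assms(2)]] digit_window[OF assms(1)]
    by (auto split: if_splits)
qed

text \<open>This is the converse of \<open>dist_le_of_common_prefix\<close>: as long as the first
  digits agree, one step multiplies the distance by exactly \<beta>, so the bound passes from
  \<open>Suc N\<close> to \<open>N\<close>.\<close>

lemma common_prefix_of_close:
  assumes "stays x" "stays y" "\<bar>x - y\<bar> < t / \<beta> ^ N" "i < N"
  shows "dbar \<beta> x i = dbar \<beta> y i"
  using assms
proof (induction N arbitrary: x y i)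
  case (Suc N)
  have *: "dbar \<beta> x 0 = dbar \<beta> y 0"
  proof -
    have "t / \<beta> ^ Suc N \<le> t / \<beta>"
      using beta t_pos one_le_power[of \<beta> N] by (simp add: field_simps)
    then have close: "\<bar>x - y\<bar> < t / \<beta>"
      using Suc.prems by linarith
    have "t \<le> Tbar \<beta> x"
      using Suc.prems stays_Tbar stays_J by fastforce
    then have "\<beta> * x > of_int (a + 1) \<Longrightarrow> \<beta> * x \<ge> of_int (a + 1) + t"
      using digit_window[OF stays_J[of x]] Suc.prems by (simp add: Tbar_eq)
    moreover have "\<beta> * \<bar>x - y\<bar> < t"
      using close beta by (simp add: field_simps)
    ultimately show ?thesis
      using digit_locally_constant[OF stays_J _ close] Suc.prems by linarith
  qed
  show ?case
  proof (cases i)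
    case (Suc j)
    have "Tbar \<beta> x - Tbar \<beta> y = \<beta> * (x - y)"
      using * by (simp add: Tbar_eq right_diff_distrib)
    then have "\<bar>Tbar \<beta> x - Tbar \<beta> y\<bar> = \<beta> * \<bar>x - y\<bar>"
      using beta by (simp add: abs_mult)
    also have "\<dots> < t / \<beta> ^ N"
      using Suc.prems(3) beta by (simp add: field_simps)
    finally have "dbar \<beta> (Tbar \<beta> x) j = dbar \<beta> (Tbar \<beta> y) j"
      using Suc.IH[of "Tbar \<beta> x" "Tbar \<beta> y" j] Suc.prems stays_Tbar Suc by simp
    then show ?thesis using Suc by (simp add: dbar_Suc)
  qed (use * in simp)
qed simp

section \<open>Orbit closures of staying points: invariance and recurrence\<close>

lemma stays_of_invariant:
  assumes "S \<subseteq> J" "Tbar \<beta> ` S \<subseteq> S" "x \<in> S"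
  shows "stays x"
proof -
  have "(Tbar \<beta> ^^ n) x \<in> S" for n
    by (induction n) (use assms in auto)
  then show ?thesis using assms(1) unfolding stays_def by blast
qed

lemma stays_of_Tbar_invariant:
  "S \<subseteq> J \<Longrightarrow> Tbar_invariant \<beta> S \<Longrightarrow> x \<in> S \<Longrightarrow> stays x"
  by (rule stays_of_invariant) (auto simp: Tbar_invariant_def)

lemma compact_orbit_closure:
  assumes "orbit_closure \<beta> x \<subseteq> J"
  shows "compact (orbit_closure \<beta> x)"
  using assms bounded_subset[OF bounded_closed_interval]
  by (auto simp: compact_eq_bounded_closed orbit_closure_def)

lemma orbit_closure_subset:
  assumes "stays y"
  shows "orbit_closure \<beta> y \<subseteq> J"
  unfolding orbit_closure_def
  by (rule closure_minimal) (use assms in \<open>auto simp: stays_def\<close>)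

lemma orbit_closure_forward:
  assumes "stays y"
  shows "Tbar \<beta> ` orbit_closure \<beta> y \<subseteq> orbit_closure \<beta> y"
proof clarify
  fix v assume v: "v \<in> orbit_closure \<beta> y"
  then have vJ: "v \<in> J" using orbit_closure_subset[OF assms] by blast
  show "Tbar \<beta> v \<in> orbit_closure \<beta> y"
    unfolding orbit_closure_def closure_approachable
  proof clarify
    fix e :: real assume e: "e > 0"
    \<comment> \<open>\<open>v\<close> is not yet known to stay. If \<open>v\<close> is right of the
      discontinuity, the last term keeps the nearby orbit point on that side; otherwise
      \<open>t / \<beta>\<close> does, since staying points on the right keep that distance. The
      term \<open>e / \<beta>\<close> controls the images.\<close>
    define \<delta> where "\<delta> = min (min (e / \<beta>) (t / \<beta>))
      (if \<beta> * v > of_int (a + 1) then (\<beta> * v - of_int (a + 1)) / \<beta> else 1)"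
    have "\<delta> > 0"
      using e beta t_pos by (auto simp: \<delta>_def)
    then obtain n where n: "\<bar>v - (Tbar \<beta> ^^ n) y\<bar> < \<delta>"
      using v unfolding orbit_closure_def closure_approachable
      by (auto simp: dist_real_def abs_minus_commute)
    let ?u = "(Tbar \<beta> ^^ n) y"
    have "dbar \<beta> v 0 = dbar \<beta> ?u 0"
      using n beta vJ stays_funpow[OF assms]
      by (intro digit_locally_constant) (auto simp: \<delta>_def field_simps)
    then have "\<bar>Tbar \<beta> v - Tbar \<beta> ?u\<bar> = \<beta> * \<bar>v - ?u\<bar>"
      using beta by (simp add: Tbar_eq abs_mult flip: right_diff_distrib)
    also have "\<dots> < e"
      using n beta by (auto simp: \<delta>_def field_simps)
    finally have "dist ((Tbar \<beta> ^^ Suc n) y) (Tbar \<beta> v) < e"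
      by (simp add: dist_real_def abs_minus_commute)
    then show "\<exists>u\<in>range (\<lambda>n. (Tbar \<beta> ^^ n) y). dist u (Tbar \<beta> v) < e"
      by blast
  qed
qed

lemma stays_orbit_closure: "stays y \<Longrightarrow> v \<in> orbit_closure \<beta> y \<Longrightarrow> stays v"
  by (rule stays_of_invariant[OF orbit_closure_subset orbit_closure_forward])

text \<open>The gap of length \<open>t / \<beta>\<close> right of the discontinuity contains no
  staying point, so nearby points of \<open>S\<close> use the same branch.\<close>

lemma continuous_on_Tbar:
  assumes "\<And>x. x \<in> S \<Longrightarrow> stays x"
  shows "continuous_on S (Tbar \<beta>)"
  unfolding continuous_on_iff
proof clarify
  fix x and e :: real assume x: "x \<in> S" and e: "e > 0"
  show "\<exists>d>0. \<forall>x'\<in>S. dist x' x < d \<longrightarrow> dist (Tbar \<beta> x') (Tbar \<beta> x) < e"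
  proof (intro exI conjI ballI impI)
    show "min (e / \<beta>) (t / \<beta>) > 0" using e beta t_pos by simp
    fix x' assume x': "x' \<in> S" "dist x' x < min (e / \<beta>) (t / \<beta>)"
    then have "dbar \<beta> x' 0 = dbar \<beta> x 0"
      using common_prefix_of_close[of x' x 1 0] assms x by (simp add: dist_real_def)
    then have "\<bar>Tbar \<beta> x' - Tbar \<beta> x\<bar> = \<beta> * \<bar>x' - x\<bar>"
      using beta by (simp add: Tbar_eq abs_mult flip: right_diff_distrib)
    then show "dist (Tbar \<beta> x') (Tbar \<beta> x) < e"
      using x' beta by (simp add: dist_real_def field_simps)
  qed
qed

text \<open>The bound \<open>K\<close> allows \<open>y\<close> itself to be dropped from its orbit:
  \<open>K = 1\<close> expresses recurrence, \<open>K = 0\<close> plain membership in the orbit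
  closure.\<close>

lemma mem_orbit_closure_of_prefixes:
  assumes "stays y" "stays x"
    and "\<And>N. \<exists>k\<ge>K. \<forall>i<N. dbar \<beta> y (k + i) = dbar \<beta> x i"
  shows "x \<in> closure ((\<lambda>n. (Tbar \<beta> ^^ n) y) ` {K..})"
  unfolding closure_approachable
proof clarify
  fix e :: real assume "e > 0"
  then obtain N where N: "(1 / \<beta>) ^ N < e"
    using ex_inverse_power_less beta by blast
  obtain k where k: "k \<ge> K" "\<forall>i<N. dbar \<beta> y (k + i) = dbar \<beta> x i"
    using assms(3) by blast
  have "\<bar>(Tbar \<beta> ^^ k) y - x\<bar> \<le> (1 / \<beta>) ^ N"
    using k(2) stays_unit stays_funpow[OF assms(1)] assms(2)
    by (intro dist_le_of_common_prefix beta) (auto simp: dbar_funpow)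
  then show "\<exists>u\<in>(\<lambda>n. (Tbar \<beta> ^^ n) y) ` {K..}. dist u x < e"
    using N k(1) by (auto simp: dist_real_def intro!: bexI[of _ k])
qed

text \<open>Only surjectivity needs recurrence. The image is compact, hence closed, and contains all
  later iterates; these accumulate at \<open>y\<close>, so the image contains the whole orbit and
  its closure.\<close>

lemma orbit_closure_invariant:
  assumes "stays y" and rec: "\<And>N. \<exists>k\<ge>1. \<forall>i<N. dbar \<beta> y (k + i) = dbar \<beta> y i"
  shows "Tbar_invariant \<beta> (orbit_closure \<beta> y)"
proof -
  let ?S = "orbit_closure \<beta> y" and ?O = "\<lambda>n. (Tbar \<beta> ^^ n) y"
  have "compact ?S"
    by (rule compact_orbit_closure[OF orbit_closure_subset[OF assms(1)]])
  then have closed: "closed (Tbar \<beta> ` ?S)"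
    using continuous_on_Tbar stays_orbit_closure[OF assms(1)]
    by (intro compact_imp_closed compact_continuous_image) auto
  have tail: "?O ` {1..} \<subseteq> Tbar \<beta> ` ?S"
  proof clarsimp
    fix n assume "Suc 0 \<le> n"
    then obtain m where "n = Suc m" by (cases n) auto
    then show "?O n \<in> Tbar \<beta> ` ?S" using orbit_mem[of m \<beta> y] by auto
  qed
  then have "closure (?O ` {1..}) \<subseteq> Tbar \<beta> ` ?S"
    using closed by (rule closure_minimal)
  then have "y \<in> Tbar \<beta> ` ?S"
    using mem_orbit_closure_of_prefixes[OF assms(1,1) rec] by blast
  then have "?O n \<in> Tbar \<beta> ` ?S" for n
    using orbit_mem[of "n - 1" \<beta> y] by (cases n) auto
  then have "range ?O \<subseteq> Tbar \<beta> ` ?S"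
    by blast
  then have "?S \<subseteq> Tbar \<beta> ` ?S"
    using closed unfolding orbit_closure_def by (rule closure_minimal)
  then show ?thesis
    using orbit_closure_forward[OF assms(1)] by (auto simp: Tbar_invariant_def)
qed

text \<open>A preimage \<open>w\<close> of \<open>x\<close> in the closure is approximated by an
  iterate of \<open>x\<close>, so one step later a prefix of \<open>x\<close> reappears. Induction
  on \<open>K\<close> pushes the return arbitrarily far.\<close>

lemma recurrent_of_invariant:
  assumes "orbit_closure \<beta> x \<subseteq> J" "Tbar_invariant \<beta> (orbit_closure \<beta> x)"
  shows "\<exists>k\<ge>K. \<forall>i<N. dbar \<beta> x (k + i) = dbar \<beta> x i"
proof (induction K)
  case (Suc K)
  then obtain k where k: "k \<ge> K" "\<forall>i<N. dbar \<beta> x (k + i) = dbar \<beta> x i" by blast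
  let ?S = "orbit_closure \<beta> x"
  have stays: "stays v" if "v \<in> ?S" for v
    using stays_of_Tbar_invariant[OF assms(1,2) that] .
  have "x \<in> Tbar \<beta> ` ?S"
    using orbit_mem[of 0 \<beta> x] assms(2) by (simp add: Tbar_invariant_def)
  then obtain w where w: "w \<in> ?S" "x = Tbar \<beta> w"
    by auto
  \<comment> \<open>One letter for the first digit of \<open>w\<close>, then \<open>k + N\<close>
    letters of \<open>x\<close>, enough to contain its known return at \<open>k\<close>; the copy
    inside gives the later return \<open>Suc n + k\<close>.\<close>
  define M where "M = Suc (k + N)"
  have "t / \<beta> ^ M > 0" using beta t_pos by simp
  then obtain n where "\<bar>(Tbar \<beta> ^^ n) x - w\<bar> < t / \<beta> ^ M"
    using w(1) unfolding orbit_closure_def closure_approachable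
    by (auto simp: dist_real_def)
  then have prefix: "dbar \<beta> ((Tbar \<beta> ^^ n) x) i = dbar \<beta> w i" if "i < M" for i
    using that orbit_mem w(1) stays by (intro common_prefix_of_close) auto
  have shift: "dbar \<beta> x (Suc n + i) = dbar \<beta> x i" if "i < k + N" for i
  proof -
    have "dbar \<beta> x (Suc n + i) = dbar \<beta> w (Suc i)"
      using prefix[of "Suc i"] that by (simp add: M_def dbar_funpow)
    also have "\<dots> = dbar \<beta> x i"
      unfolding w(2) by (rule dbar_Suc)
    finally show ?thesis .
  qed
  have "dbar \<beta> x (Suc n + k + i) = dbar \<beta> x i" if "i < N" for i
    using shift[of "k + i"] k(2) that by (simp add: add.assoc)
  then show ?case
    using k(1) by (intro exI[of _ "Suc n + k"]) auto
qed (auto intro: exI[of _ 0])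

end

section \<open>Mechanical words\<close>

lemma sum_upper_mechanical: "(\<Sum>k<n. upper_mechanical \<alpha> k) = \<lceil>\<alpha> * real n\<rceil>"
  by (induction n) (simp_all add: upper_mechanical_def add.commute)

lemma sum_lower_mechanical: "(\<Sum>k<n. lower_mechanical \<alpha> k) = \<lfloor>\<alpha> * real n\<rfloor>"
  by (induction n) (simp_all add: lower_mechanical_def add.commute)

lemma irrational_multiple_not_int:
  fixes \<alpha> :: real
  assumes "\<alpha> \<notin> \<rat>" "m > 0"
  shows "\<alpha> * real m \<notin> \<int>"
proof
  assume "\<alpha> * real m \<in> \<int>"
  then have "\<alpha> * real m / real m \<in> \<rat>"
    by (meson Ints_subset_Rats Rats_divide Rats_of_nat subsetD)
  then show False using assms by simp
qed

lemma rational_multiple_int: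
  fixes \<alpha> :: real
  assumes "\<alpha> \<in> \<rat>"
  obtains q :: nat where "q > 0" "\<alpha> * real q \<in> \<int>"
proof -
  obtain i :: int and n :: nat where "n \<noteq> 0" "\<alpha> = of_int i / real n"
    using assms by (auto simp: Rats_eq_int_div_nat)
  then show thesis by (intro that[of n]) auto
qed

lemma upper_mechanical_of_int: "upper_mechanical (of_int d) = (\<lambda>_. d)"
proof
  fix n
  have "\<lceil>of_int d * (real n + 1)\<rceil> = d * (int n + 1)"
    using ceiling_of_int[of "d * (int n + 1)", where 'a = real] by simp
  moreover have "\<lceil>of_int d * real n\<rceil> = d * int n"
    using ceiling_of_int[of "d * int n", where 'a = real] by simp
  ultimately show "upper_mechanical (of_int d) n = d"
    by (simp add: upper_mechanical_def algebra_simps)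
qed

text \<open>The shift is the one that maximises the fractional part of \<open>\<alpha> k\<close>.\<close>
lemma upper_mechanical_is_shift_of_lower:
  assumes "\<alpha> \<in> \<rat>"
  obtains k :: nat where "\<And>n. \<lfloor>\<alpha> * real (k + n)\<rfloor> - \<lfloor>\<alpha> * real k\<rfloor> = \<lceil>\<alpha> * real n\<rceil>"
proof -
  obtain q where q: "q > 0" "\<alpha> * real q \<in> \<int>"
    using assms by (rule rational_multiple_int)
  then obtain p where p: "\<alpha> * real q = of_int p" by (auto elim: Ints_cases)
  define f where "f k = frac (\<alpha> * real k)" for k :: nat
  have "f k = f (k mod q)" for k
  proof -
    have "\<alpha> * real k = \<alpha> * real (k mod q + q * (k div q))"
      by simp
    also have "\<dots> = \<alpha> * real (k mod q) + (\<alpha> * real q) * real (k div q)"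
      by (simp only: of_nat_add of_nat_mult distrib_left mult.assoc)
    also have "\<dots> = \<alpha> * real (k mod q) + of_int (p * int (k div q))"
      by (simp add: p)
    finally show ?thesis
      unfolding f_def frac_def by (simp only: floor_add_int[symmetric])
  qed
  then have "range f \<subseteq> f ` {..<q}"
    using q(1) by (auto intro!: image_eqI[of _ _ "_ mod q"])
  then have fin: "finite (range f)"
    by (rule finite_subset) simp
  then obtain k where k: "f k = Max (range f)"
    using Max_in[of "range f"] by (metis UNIV_not_empty image_iff image_is_empty)
  have max: "f n \<le> f k" for n
    unfolding k using fin by (intro Max_ge) auto
  have "\<lfloor>\<alpha> * real (k + n)\<rfloor> - \<lfloor>\<alpha> * real k\<rfloor> = \<lceil>\<alpha> * real n\<rceil>" for n
  proof (cases "\<alpha> * real n \<in> \<int>")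
    case True
    then obtain j where "\<alpha> * real n = of_int j" by (auto elim: Ints_cases)
    then show ?thesis by (simp add: distrib_left)
  next
    case False
    then have "f n > 0" by (simp add: f_def frac_gt_0_iff)
    \<comment> \<open>Without a carry the fractional part at \<open>k + n\<close> would exceed the
      maximum at \<open>k\<close>; so a carry occurs and raises the floor to the ceiling.\<close>
    have "\<not> frac (\<alpha> * real k) + frac (\<alpha> * real n) < 1"
    proof
      assume "frac (\<alpha> * real k) + frac (\<alpha> * real n) < 1"
      then have "f (k + n) = f k + f n"
        by (simp add: f_def distrib_left frac_add)
      then show False using max[of "k + n"] \<open>f n > 0\<close> by simp
    qed
    then have "\<lfloor>\<alpha> * real k + \<alpha> * real n\<rfloor> = \<lfloor>\<alpha> * real k\<rfloor> + \<lfloor>\<alpha> * real n\<rfloor> + 1"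
      by (simp add: floor_add)
    moreover have "\<lceil>\<alpha> * real n\<rceil> = \<lfloor>\<alpha> * real n\<rfloor> + 1"
      using False by (metis Ints_of_int ceiling_altdef)
    ultimately show ?thesis by (simp add: distrib_left)
  qed
  then show thesis by (rule that)
qed

section \<open>Consequences of a staying point with upper mechanical expansion\<close>

locale mechanical_point = beta_window +
  fixes y \<alpha> :: real
  assumes stays_y: "stays y" and dbar_y: "dbar \<beta> y = upper_mechanical \<alpha>"
begin

lemma digit_sum_y: "digit_sum \<beta> y n = \<lceil>\<alpha> * real n\<rceil>"
  by (simp add: digit_sum_def dbar_y sum_upper_mechanical)

lemma digit_sum_orbit_y:
  "digit_sum \<beta> ((Tbar \<beta> ^^ k) y) n = \<lceil>\<alpha> * real (k + n)\<rceil> - \<lceil>\<alpha> * real k\<rceil>"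
  using digit_sum_add[of \<beta> y k n] by (simp add: digit_sum_y)

text \<open>Comparison with \<open>y\<close> costs at most one and rounding to the ceiling at most
  another one. The bound does not depend on \<open>n\<close>, which yields the frequency.\<close>

lemma digit_sum_near:
  assumes "stays x"
  shows "\<bar>real_of_int (digit_sum \<beta> x n) - \<alpha> * real n\<bar> \<le> 2"
proof -
  have "\<bar>digit_sum \<beta> x n - \<lceil>\<alpha> * real n\<rceil>\<bar> \<le> 1"
    using digit_sum_diff[OF assms stays_y, of n] by (simp add: digit_sum_y)
  then show ?thesis by linarith
qed

lemma frequency:
  assumes "stays x"
  shows "has_frequency \<beta> x \<alpha>"
  unfolding has_frequency_def
proof (rule LIM_zero_cancel, rule Lim_null_comparison)
  show "(\<lambda>n. 2 / real n) \<longlonglongrightarrow> 0"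
    by (rule lim_const_over_n)
  have "norm (1 / real n * (\<Sum>k<n. real_of_int (dbar \<beta> x k)) - \<alpha>) \<le> 2 / real n" if "n > 0" for n
  proof -
    have "1 / real n * (\<Sum>k<n. real_of_int (dbar \<beta> x k)) - \<alpha>
        = (real_of_int (digit_sum \<beta> x n) - \<alpha> * real n) / real n"
      using that by (simp add: digit_sum_def field_simps)
    then show ?thesis
      using digit_sum_near[OF assms, of n] that by (simp add: divide_right_mono)
  qed
  then show "\<forall>\<^sub>F n in sequentially.
      norm (1 / real n * (\<Sum>k<n. real_of_int (dbar \<beta> x k)) - \<alpha>) \<le> 2 / real n"
    by (intro eventually_sequentiallyI[of 1]) auto
qed

text \<open>Over \<open>k\<close> blocks of length \<open>n\<close> an excess of \<open>c\<close>
  over \<open>\<alpha> * real n\<close> would grow linearly in \<open>k\<close>, against the bounded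
  deviation in \<open>digit_sum_near\<close>.\<close>

lemma digit_sum_average_ge:
  assumes "stays x" "\<And>m. c \<le> digit_sum \<beta> ((Tbar \<beta> ^^ m) x) n"
  shows "of_int c \<le> \<alpha> * real n"
proof (rule ccontr)
  assume "\<not> ?thesis"
  then obtain k where k: "real k * (of_int c - \<alpha> * real n) > 2"
    using reals_Archimedean3[of "of_int c - \<alpha> * real n"] by auto
  have "int k * c \<le> digit_sum \<beta> x (k * n)"
    unfolding digit_sum_blocks using sum_mono[of "{..<k}" "\<lambda>_. c"] assms(2) by simp
  then have "real k * of_int c \<le> of_int (digit_sum \<beta> x (k * n))"
    by (metis of_int_le_iff of_int_mult of_int_of_nat_eq)
  then show False
    using digit_sum_near[OF assms(1), of "k * n"] k by (simp add: algebra_simps)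
qed

lemma digit_sum_average_le:
  assumes "stays x" "\<And>m. digit_sum \<beta> ((Tbar \<beta> ^^ m) x) n \<le> c"
  shows "\<alpha> * real n \<le> of_int c"
proof (rule ccontr)
  assume "\<not> ?thesis"
  then obtain k where k: "real k * (\<alpha> * real n - of_int c) > 2"
    using reals_Archimedean3[of "\<alpha> * real n - of_int c"] by auto
  have "digit_sum \<beta> x (k * n) \<le> int k * c"
    unfolding digit_sum_blocks using sum_mono[of "{..<k}" _ "\<lambda>_. c"] assms(2) by simp
  then have "of_int (digit_sum \<beta> x (k * n)) \<le> real k * of_int c"
    by (metis of_int_le_iff of_int_mult of_int_of_nat_eq)
  then show False
    using digit_sum_near[OF assms(1), of "k * n"] k by (simp add: algebra_simps)
qed

text \<open>All digit sums of length \<open>n\<close> differ by at most one, so a defect \<open>\<noteq> 0\<close> always has the same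
  sign; by recurrence it would occur twice at a distance divisible by \<open>n\<close> and accumulate to \<open>2\<close>.\<close>
lemma digit_sum_integer_multiple:
  assumes "orbit_closure \<beta> x \<subseteq> J" "Tbar_invariant \<beta> (orbit_closure \<beta> x)"
    and v: "v \<in> orbit_closure \<beta> x" and int: "\<alpha> * real n \<in> \<int>"
  shows "digit_sum \<beta> v n = \<lceil>\<alpha> * real n\<rceil>"
proof (rule ccontr)
  define p where "p = \<lceil>\<alpha> * real n\<rceil>"
  assume neq: "digit_sum \<beta> v n \<noteq> \<lceil>\<alpha> * real n\<rceil>"
  have p: "of_int p = \<alpha> * real n"
    using int by (auto simp: p_def elim: Ints_cases)
  have "n > 0"
    using neq by (cases n) auto
  \<comment> \<open>The sign treats surplus and deficit at once: multiplied by \<sigma>, all defects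
    of staying points become nonnegative.\<close>
  define \<sigma> where "\<sigma> = sgn (digit_sum \<beta> v n - p)"
  have \<sigma>: "\<bar>\<sigma>\<bar> = 1" "\<sigma> * (digit_sum \<beta> v n - p) \<ge> 1"
    using neq by (auto simp: \<sigma>_def p_def sgn_if)
  have stays: "stays u" if "u \<in> orbit_closure \<beta> x" for u
    using stays_of_Tbar_invariant[OF assms(1,2) that] .
  \<comment> \<open>\<open>v\<close> need not lie on the orbit of \<open>x\<close>; an orbit point
    close to it shares its first \<open>n\<close> digits and hence its defect.\<close>
  have "t / \<beta> ^ n > 0" using beta t_pos by simp
  then obtain m where m: "\<bar>(Tbar \<beta> ^^ m) x - v\<bar> < t / \<beta> ^ n"
    using v unfolding orbit_closure_def closure_approachable by (auto simp: dist_real_def)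
  define x1 where "x1 = (Tbar \<beta> ^^ m) x"
  have x1: "stays x1" "digit_sum \<beta> x1 n = digit_sum \<beta> v n"
    using m stays orbit_mem v
    by (auto simp: x1_def intro!: digit_sum_cong common_prefix_of_close[of _ _ n])
  have nonneg: "\<sigma> * (digit_sum \<beta> u n - p) \<ge> 0" if "stays u" for u
  proof -
    have "\<bar>digit_sum \<beta> u n - digit_sum \<beta> v n\<bar> \<le> 1"
      using digit_sum_diff that stays v by blast
    then show ?thesis
      using \<sigma> by (auto simp: abs_if split: if_splits)
  qed
  define A where "A = {k. digit_sum \<beta> ((Tbar \<beta> ^^ k) x1) n = digit_sum \<beta> v n}"
  have "infinite A"
    unfolding infinite_nat_iff_unbounded_le
  proof
    fix K
    \<comment> \<open>Since \<open>x1\<close> lies \<open>m\<close> steps along the orbit, a return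
      of its \<open>n\<close> digits follows from one of the first \<open>m + n\<close> digits of
      \<open>x\<close>.\<close>
    obtain k where k: "k \<ge> K" "\<forall>i<m + n. dbar \<beta> x (k + i) = dbar \<beta> x i"
      using recurrent_of_invariant[OF assms(1,2)] by blast
    have "dbar \<beta> ((Tbar \<beta> ^^ k) x1) i = dbar \<beta> x1 i" if "i < n" for i
      using k(2)[rule_format, of "m + i"] that by (simp add: x1_def dbar_funpow add.left_commute)
    then have "k \<in> A"
      using x1(2) by (auto simp: A_def cong: digit_sum_cong)
    then show "\<exists>k\<ge>K. k \<in> A" using k(1) by blast
  qed
  \<comment> \<open>Equal residues modulo \<open>n\<close> make the stretch between two occurrences
    a union of whole blocks of length \<open>n\<close>.\<close>
  moreover have "finite ((\<lambda>k. k mod n) ` A)"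
    by (rule finite_subset[of _ "{..<n}"]) (use \<open>n > 0\<close> in auto)
  ultimately obtain k0 where "infinite {k \<in> A. k mod n = k0 mod n}"
    using pigeonhole_infinite by blast
  note unbounded = this[unfolded infinite_nat_iff_unbounded]
  obtain k1 where k1: "k1 \<in> A" "k1 mod n = k0 mod n"
    using unbounded by blast
  obtain k2 where k2: "k2 > k1" "k2 \<in> A" "k2 mod n = k0 mod n"
    using unbounded by blast
  then obtain j where j: "k2 = k1 + j * n"
    using k1 mod_eq_dvd_iff_nat[of k1 k2 n]
    by (auto elim!: dvdE simp: mult.commute) (metis le_add_diff_inverse less_imp_le)
  then have "j > 0" using k2 by (cases j) auto
  define z where "z = (Tbar \<beta> ^^ k1) x1"
  have z: "stays z" using x1 stays_funpow by (simp add: z_def)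
  define h where "h i = \<sigma> * (digit_sum \<beta> ((Tbar \<beta> ^^ (i * n)) z) n - p)" for i
  have h0: "h 0 \<ge> 1"
    using k1 \<sigma> by (simp add: h_def z_def A_def)
  have "(Tbar \<beta> ^^ (j * n)) z = (Tbar \<beta> ^^ k2) x1"
    using funpow_add[of "j * n" k1 "Tbar \<beta>"] by (simp add: j z_def add.commute)
  then have hj: "h j \<ge> 1"
    using k2 \<sigma> by (simp add: h_def A_def)
  have "h 0 \<le> (\<Sum>i<j. h i)"
    using \<open>j > 0\<close> nonneg stays_funpow[OF z] by (intro member_le_sum) (auto simp: h_def)
  then have "2 \<le> (\<Sum>i<Suc j. h i)"
    using h0 hj by simp
  also have "\<dots> = \<sigma> * (digit_sum \<beta> z (Suc j * n) - int (Suc j) * p)"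
    unfolding digit_sum_blocks h_def
    by (simp only: sum_subtractf sum_distrib_left[symmetric]) simp
  \<comment> \<open>\<open>y\<close> has no defect at this length, so the total defect is a
    difference of digit sums of two staying points.\<close>
  also have "\<dots> = \<sigma> * (digit_sum \<beta> z (Suc j * n) - digit_sum \<beta> y (Suc j * n))"
  proof -
    have "\<alpha> * real (Suc j * n) = of_int (int (Suc j) * p)"
      using p by (simp add: algebra_simps)
    then have "\<lceil>\<alpha> * real (Suc j * n)\<rceil> = int (Suc j) * p"
      by (simp only: ceiling_of_int)
    then show ?thesis by (simp add: digit_sum_y)
  qed
  also have "\<dots> \<le> 1"
    using digit_sum_diff[OF z stays_y, of "Suc j * n"] \<sigma>(1) by (auto simp: abs_if split: if_splits)
  finally show False by simp
qed

text \<open>By monotonicity the digit sum of the maximum \<open>M\<close> bounds those along the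
  orbit and exceeds none by more than one. Averaging puts \<open>\<alpha> * real n\<close> between
  this sum minus one and the sum. The lower end is possible only for an integer, where
  \<open>digit_sum_integer_multiple\<close> decides.\<close>

lemma max_of_invariant:
  assumes "orbit_closure \<beta> x \<subseteq> J" "Tbar_invariant \<beta> (orbit_closure \<beta> x)"
  shows "y \<in> orbit_closure \<beta> x" "v \<in> orbit_closure \<beta> x \<Longrightarrow> v \<le> y"
proof -
  let ?S = "orbit_closure \<beta> x"
  have stays: "stays u" if "u \<in> ?S" for u
    using stays_of_Tbar_invariant[OF assms(1,2) that] .
  have "compact ?S"
    by (rule compact_orbit_closure[OF assms(1)])
  moreover have "?S \<noteq> {}" using orbit_mem by blast
  ultimately obtain M where M: "M \<in> ?S" "\<And>u. u \<in> ?S \<Longrightarrow> u \<le> M"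
    using compact_attains_sup[of ?S] by blast
  have "digit_sum \<beta> M n = \<lceil>\<alpha> * real n\<rceil>" for n
  proof (cases "\<alpha> * real n \<in> \<int>")
    case True
    then show ?thesis using digit_sum_integer_multiple assms M(1) by blast
  next
    case False
    have orb: "stays x" "stays ((Tbar \<beta> ^^ m) x)" "(Tbar \<beta> ^^ m) x \<le> M" for m
      using orbit_mem[of m \<beta> x] orbit_mem[of 0 \<beta> x] stays M by auto
    have le: "digit_sum \<beta> ((Tbar \<beta> ^^ m) x) n \<le> digit_sum \<beta> M n" for m
      using orb stays M(1) by (intro digit_sum_mono) auto
    have ge: "digit_sum \<beta> M n - 1 \<le> digit_sum \<beta> ((Tbar \<beta> ^^ m) x) n" for m
      using digit_sum_diff[OF orb(2) stays[OF M(1)], of m n] by linarith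
    have "\<alpha> * real n \<le> of_int (digit_sum \<beta> M n)"
      by (rule digit_sum_average_le[OF orb(1) le])
    moreover have "of_int (digit_sum \<beta> M n - 1) \<le> \<alpha> * real n"
      by (rule digit_sum_average_ge[OF orb(1) ge])
    moreover have "of_int (digit_sum \<beta> M n - 1) \<noteq> \<alpha> * real n"
      using False by (metis Ints_of_int)
    ultimately show ?thesis
      by (intro ceiling_unique[symmetric]) auto
  qed
  then have "dbar \<beta> M i = dbar \<beta> y i" for i
    by (intro dbar_eq_of_digit_sum[of "Suc i"]) (auto simp: digit_sum_y)
  then have "M = y"
    using dbar_inj[OF beta, of M y] stays_unit stays[OF M(1)] stays_y by auto
  then show "y \<in> ?S" "v \<in> ?S \<Longrightarrow> v \<le> y"
    using M by auto
qed

text \<open>Here \<open>frac (real k * - \<alpha>)\<close> is the amount \<open>u\<close> by which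
  \<open>\<lceil>\<alpha> * real k\<rceil>\<close> exceeds \<open>\<alpha> * real k\<close>. The
  digit sum is the ceiling of \<open>\<alpha> * real m - u\<close>, which drops by one exactly when
  \<open>u\<close> reaches \<open>frac (\<alpha> * real m)\<close>.\<close>

lemma digit_sum_orbit_y_irrational:
  assumes "\<alpha> \<notin> \<rat>" "m > 0"
  shows "digit_sum \<beta> ((Tbar \<beta> ^^ k) y) m =
    (if frac (real k * - \<alpha>) < frac (\<alpha> * real m) then \<lceil>\<alpha> * real m\<rceil> else \<lceil>\<alpha> * real m\<rceil> - 1)"
proof -
  have not_int: "\<alpha> * real m \<notin> \<int>"
    by (rule irrational_multiple_not_int[OF assms])
  then have "\<lceil>\<alpha> * real m\<rceil> = \<lfloor>\<alpha> * real m\<rfloor> + 1"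
    by (metis Ints_of_int ceiling_altdef)
  then have m: "\<alpha> * real m = of_int \<lceil>\<alpha> * real m\<rceil> - 1 + frac (\<alpha> * real m)"
      "frac (\<alpha> * real m) > 0"
    using not_int by (simp_all add: frac_gt_0_iff) (simp add: frac_def)
  have k: "\<alpha> * real k = of_int \<lceil>\<alpha> * real k\<rceil> - frac (real k * - \<alpha>)"
    by (simp add: frac_def floor_minus mult.commute)
  have "\<lceil>\<alpha> * real (k + m)\<rceil> = \<lceil>\<alpha> * real k\<rceil> +
    (if frac (real k * - \<alpha>) < frac (\<alpha> * real m) then \<lceil>\<alpha> * real m\<rceil> else \<lceil>\<alpha> * real m\<rceil> - 1)"
    using m k frac_lt_1[of "\<alpha> * real m"] frac_ge_0[of "real k * - \<alpha>"] frac_lt_1[of "real k * - \<alpha>"]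
    unfolding of_nat_add distrib_left by (intro ceiling_unique; split if_split; safe; linarith)
  then show ?thesis by (simp add: digit_sum_orbit_y)
qed

text \<open>The digit sum of length \<open>m\<close> of the \<open>k\<close>-th orbit point is determined by the position of
  \<open>\<lceil>\<alpha> k\<rceil> - \<alpha> k\<close> relative to the thresholds \<open>frac (\<alpha> m)\<close>. By density of these positions and
  monotonicity of the digit sums, every \<open>x\<close> has a position of its own.\<close>
lemma irrational_prefix_occurs:
  assumes irr: "\<alpha> \<notin> \<rat>" and x: "stays x" "x \<le> y"
  obtains k where "k > 0" "\<And>m. m \<le> N \<Longrightarrow> digit_sum \<beta> ((Tbar \<beta> ^^ k) y) m = digit_sum \<beta> x m"
proof -
  define f where "f m = frac (\<alpha> * real m)" for m
  define c where "c m = \<lceil>\<alpha> * real m\<rceil>" for m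
  have irr': "- \<alpha> \<notin> \<rat>" using irr by simp
  have dense: "\<exists>k>0. l < frac (real k * - \<alpha>) \<and> frac (real k * - \<alpha>) < h"
    if "0 \<le> l" "l < h" "h \<le> 1" for l h
  proof -
    have "0 \<le> (l + h) / 2" "(l + h) / 2 \<le> 1" "(h - l) / 2 > 0"
      using that by auto
    from Kronecker_approx_1_explicit[OF irr' this]
    obtain k where k: "k > 0" "\<bar>frac (real k * - \<alpha>) - (l + h) / 2\<bar> < (h - l) / 2"
      by blast
    show ?thesis
    proof (intro exI conjI)
      show "l < frac (real k * - \<alpha>)" "frac (real k * - \<alpha>) < h"
        using k(2) unfolding abs_diff_less_iff by argo+
    qed (fact k(1))
  qed
  have y_sum: "digit_sum \<beta> ((Tbar \<beta> ^^ k) y) m = (if frac (real k * - \<alpha>) < f m then c m else c m - 1)"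
    if "m > 0" for k m
    using digit_sum_orbit_y_irrational[OF irr that] by (simp add: f_def c_def)
  have x_sum: "digit_sum \<beta> x m = c m \<or> digit_sum \<beta> x m = c m - 1" for m
    using digit_sum_order[OF x(1) stays_y x(2), of m] by (auto simp: digit_sum_y c_def)
  have f_le: "f m' \<le> f m"
    if "m > 0" "m' > 0" "digit_sum \<beta> x m = c m" "digit_sum \<beta> x m' = c m' - 1" for m m'
  proof (rule ccontr)
    assume "\<not> f m' \<le> f m"
    \<comment> \<open>An orbit point positioned between the two thresholds has a smaller sum than
      \<open>x\<close> at \<open>m\<close>, hence lies weakly left of \<open>x\<close>, yet a larger
      sum at \<open>m'\<close>.\<close>
    then obtain k where k: "f m < frac (real k * - \<alpha>)" "frac (real k * - \<alpha>) < f m'"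
      using dense[of "f m" "f m'"] by (auto simp: f_def less_imp_le[OF frac_lt_1])
    have "digit_sum \<beta> ((Tbar \<beta> ^^ k) y) m < digit_sum \<beta> x m"
      using k that by (simp add: y_sum)
    then have "(Tbar \<beta> ^^ k) y \<le> x"
      using digit_sum_mono[OF x(1) stays_funpow[OF stays_y], of k m] by linarith
    then have "digit_sum \<beta> ((Tbar \<beta> ^^ k) y) m' \<le> digit_sum \<beta> x m'"
      using digit_sum_mono[OF stays_funpow[OF stays_y] x(1)] by blast
    then show False using k that by (simp add: y_sum)
  qed
  have f_less: "f m' < f m"
    if "m > 0" "m' > 0" "digit_sum \<beta> x m = c m" "digit_sum \<beta> x m' = c m' - 1" for m m'
  proof -
    have "f m' \<noteq> f m"
    proof
      assume "f m' = f m"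
      then have *: "\<alpha> * (real m' - real m) = of_int (\<lfloor>\<alpha> * real m'\<rfloor> - \<lfloor>\<alpha> * real m\<rfloor>)"
        by (simp add: f_def frac_def algebra_simps)
      have "m \<noteq> m'" using that by auto
      then have "\<alpha> = of_int (\<lfloor>\<alpha> * real m'\<rfloor> - \<lfloor>\<alpha> * real m\<rfloor>) / (real m' - real m)"
        unfolding *[symmetric] by simp
      then have "\<alpha> \<in> \<rat>"
        by (metis Rats_diff Rats_divide Rats_of_int Rats_of_nat)
      then show False using irr by simp
    qed
    then show ?thesis using f_le[OF that] by simp
  qed
  have f_pos: "f m > 0" if "m > 0" for m
    using irrational_multiple_not_int[OF irr that] by (simp add: f_def frac_gt_0_iff)
  define A where "A = {m \<in> {1..N}. digit_sum \<beta> x m = c m}"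
  define B where "B = {m \<in> {1..N}. digit_sum \<beta> x m = c m - 1}"
  have fin: "finite A" "finite B" by (auto simp: A_def B_def)
  \<comment> \<open>A position above the thresholds in \<open>B\<close> and below those in
    \<open>A\<close> reproduces all sums of \<open>x\<close>. Inserting 0 and 1 covers empty sets
    and keeps the interval inside the unit interval.\<close>
  define l where "l = Max (insert 0 (f ` B))"
  define h where "h = Min (insert 1 (f ` A))"
  have "l < h"
    unfolding l_def h_def using fin
    by (auto simp: A_def B_def f_pos intro: f_less) (simp_all add: f_def frac_lt_1)
  moreover have "0 \<le> l" "h \<le> 1"
    unfolding l_def h_def using fin by auto
  ultimately obtain k where k: "k > 0" "l < frac (real k * - \<alpha>)" "frac (real k * - \<alpha>) < h"
    using dense by blast
  have "digit_sum \<beta> ((Tbar \<beta> ^^ k) y) m = digit_sum \<beta> x m" if "m \<le> N" for m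
  proof (cases "m = 0")
    case False
    then have "m \<in> A \<or> m \<in> B"
      using that x_sum by (auto simp: A_def B_def)
    then show ?thesis
    proof
      assume m: "m \<in> A"
      then have "h \<le> f m" unfolding h_def using fin by auto
      then show ?thesis using k m False by (simp add: y_sum A_def)
    next
      assume m: "m \<in> B"
      then have "f m \<le> l" unfolding l_def using fin by auto
      then show ?thesis using k m False by (simp add: y_sum B_def)
    qed
  qed simp
  then show thesis using that k(1) by blast
qed

text \<open>For rational slope the word is periodic; for irrational slope every prefix of
  \<open>y\<close> occurs again, by \<open>irrational_prefix_occurs\<close> applied to
  \<open>y\<close> itself.\<close>

lemma recurrent_y: "\<exists>k\<ge>1. \<forall>i<N. dbar \<beta> y (k + i) = dbar \<beta> y i"
proof -
  have "\<exists>k>0. \<forall>m\<le>N. digit_sum \<beta> ((Tbar \<beta> ^^ k) y) m = digit_sum \<beta> y m"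
  proof (cases "\<alpha> \<in> \<rat>")
    case True
    then obtain q where q: "q > 0" "\<alpha> * real q \<in> \<int>" by (rule rational_multiple_int)
    then obtain p where "\<alpha> * real q = of_int p" by (auto elim: Ints_cases)
    then have "digit_sum \<beta> ((Tbar \<beta> ^^ q) y) m = digit_sum \<beta> y m" for m
      by (simp add: digit_sum_orbit_y digit_sum_y distrib_left add.commute[of "of_int p"])
    then show ?thesis using q by blast
  next
    case False
    then show ?thesis
      using irrational_prefix_occurs[OF _ stays_y order_refl] by metis
  qed
  then obtain k where k: "k > 0" "\<And>m. m \<le> N \<Longrightarrow> digit_sum \<beta> ((Tbar \<beta> ^^ k) y) m = digit_sum \<beta> y m"
    by blast
  have "dbar \<beta> ((Tbar \<beta> ^^ k) y) i = dbar \<beta> y i" if "i < N" for i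
    using dbar_eq_of_digit_sum[OF k(2) that] .
  then show ?thesis
    using k(1) by (intro exI[of _ k]) (auto simp: dbar_funpow)
qed

lemma invariant_y: "Tbar_invariant \<beta> (orbit_closure \<beta> y)"
  using orbit_closure_invariant[OF stays_y] recurrent_y by blast

text \<open>One inclusion holds because \<open>y\<close> is the maximum of the closure. Conversely
  \<open>x\<close> is an iterate of \<open>y\<close> for rational slope, and a limit of iterates for
  irrational slope.\<close>

lemma invariant_orbit_closure_unique:
  assumes S: "orbit_closure \<beta> x \<subseteq> J" "Tbar_invariant \<beta> (orbit_closure \<beta> x)"
  shows "orbit_closure \<beta> x = orbit_closure \<beta> y"
proof
  have stays: "stays u" if "u \<in> orbit_closure \<beta> x" for u
    using stays_of_Tbar_invariant[OF S(1,2) that] .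
  have orbit_sub: "orbit_closure \<beta> u \<subseteq> orbit_closure \<beta> v"
    if "u \<in> orbit_closure \<beta> v" "Tbar \<beta> ` orbit_closure \<beta> v \<subseteq> orbit_closure \<beta> v" for u v
  proof -
    have "(Tbar \<beta> ^^ n) u \<in> orbit_closure \<beta> v" for n
      by (induction n) (use that in auto)
    then show ?thesis
      unfolding orbit_closure_def[of \<beta> u]
      by (intro closure_minimal) (auto simp: orbit_closure_def)
  qed
  show "orbit_closure \<beta> y \<subseteq> orbit_closure \<beta> x"
    using max_of_invariant(1)[OF S] S(2) by (intro orbit_sub) (auto simp: Tbar_invariant_def)
  have x: "x \<in> orbit_closure \<beta> x" using orbit_mem[of 0 \<beta> x] by simp
  have "x \<in> orbit_closure \<beta> y"
  proof (cases "\<alpha> \<in> \<rat>")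
    case True
    then obtain q where q: "q > 0" "\<alpha> * real q \<in> \<int>" by (rule rational_multiple_int)
    have per: "(Tbar \<beta> ^^ q) u = u" if u: "u \<in> orbit_closure \<beta> x" for u
    proof (rule dbar_inj[OF beta])
      have "dbar \<beta> u (q + i) = dbar \<beta> u i" for i
      proof -
        have orb: "(Tbar \<beta> ^^ n) u \<in> orbit_closure \<beta> x" for n
          by (induction n) (use u S(2) in \<open>auto simp: Tbar_invariant_def\<close>)
        \<comment> \<open>Adjacent windows of length \<open>q\<close> have equal sums, so the digit
          leaving equals the digit entering.\<close>
        have "digit_sum \<beta> ((Tbar \<beta> ^^ i) u) q = digit_sum \<beta> ((Tbar \<beta> ^^ Suc i) u) q"
          unfolding digit_sum_integer_multiple[OF S orb q(2)] ..
        then show ?thesis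
          using digit_sum_add[of \<beta> u i q] digit_sum_add[of \<beta> u "Suc i" q]
          by (simp add: digit_sum_Suc add.commute)
      qed
      then show "dbar \<beta> ((Tbar \<beta> ^^ q) u) = dbar \<beta> u"
        by (auto simp: dbar_funpow)
    qed (use stays[OF u] stays_funpow stays_unit in auto)
    have "finite (range (\<lambda>n. (Tbar \<beta> ^^ n) x))"
    proof (rule finite_subset)
      show "range (\<lambda>n. (Tbar \<beta> ^^ n) x) \<subseteq> (\<lambda>n. (Tbar \<beta> ^^ n) x) ` {..<q}"
        using funpow_mod_eq[OF per[OF x]] q(1)
        by (auto intro!: image_eqI[of _ _ "_ mod q"])
    qed simp
    then have "orbit_closure \<beta> x = range (\<lambda>n. (Tbar \<beta> ^^ n) x)"
      by (simp add: orbit_closure_def finite_imp_closed)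
    then obtain k where k: "y = (Tbar \<beta> ^^ k) x"
      using max_of_invariant(1)[OF S] by auto
    \<comment> \<open>These further steps complete the \<open>k\<close> steps from \<open>x\<close>
      to \<open>y\<close> to a multiple of the period; the subtraction does not truncate because
      \<open>q > 0\<close>.\<close>
    have "(Tbar \<beta> ^^ (q * k - k)) y = (Tbar \<beta> ^^ (q * k - k + k)) x"
      unfolding k by (simp add: funpow_add)
    also have "q * k - k + k = q * k"
      using q(1) by simp
    also have "(Tbar \<beta> ^^ (q * k)) x = x"
      using funpow_mod_eq[OF per[OF x], of "q * k"] by simp
    finally show ?thesis using orbit_mem by metis
  next
    case False
    have "\<exists>k\<ge>0. \<forall>i<N. dbar \<beta> y (k + i) = dbar \<beta> x i" for N
    proof -
      obtain k where k: "\<And>m. m \<le> N \<Longrightarrow> digit_sum \<beta> ((Tbar \<beta> ^^ k) y) m = digit_sum \<beta> x m"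
        using irrational_prefix_occurs[OF False stays[OF x] max_of_invariant(2)[OF S x]] by metis
      then show ?thesis
        using dbar_eq_of_digit_sum[OF k] by (auto simp: dbar_funpow intro!: exI[of _ k])
    qed
    then show ?thesis
      using mem_orbit_closure_of_prefixes[OF stays_y stays[OF x], of 0]
      by (simp add: orbit_closure_def atLeast_0)
  qed
  then show "orbit_closure \<beta> x \<subseteq> orbit_closure \<beta> y"
    using orbit_closure_forward[OF stays_y] by (intro orbit_sub)
qed

lemma word_value_y: "word_value \<beta> (upper_mechanical \<alpha>) = y"
  using word_value_dbar[OF beta] stays_unit[OF stays_y] by (simp flip: dbar_y)

theorem mechanical_orbit_closure:
  defines "S \<equiv> orbit_closure \<beta> (word_value \<beta> (upper_mechanical \<alpha>))"
  shows "S \<subseteq> J \<and> Tbar_invariant \<beta> S \<and>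
    unique_invariant_orbit_closure_in \<beta> J S \<and> set_has_frequency \<beta> S \<alpha>"
proof -
  have "is_orbit_closure \<beta> (orbit_closure \<beta> y)"
    using stays_unit[OF stays_y] by (auto simp: is_orbit_closure_def)
  then have "unique_invariant_orbit_closure_in \<beta> J (orbit_closure \<beta> y)"
    unfolding unique_invariant_orbit_closure_in_def
    using invariant_orbit_closure_unique invariant_y orbit_closure_subset[OF stays_y]
    by (metis is_orbit_closure_def)
  then show ?thesis
    using invariant_y orbit_closure_subset[OF stays_y] frequency stays_orbit_closure[OF stays_y]
    by (auto simp: S_def word_value_y set_has_frequency_def)
qed

end

section \<open>Existence of the mechanical point\<close>

lemma dbar_fixed_point:
  assumes "0 < p" "p \<le> 1" "(\<beta> - 1) * p = of_int d"
  shows "dbar \<beta> p = (\<lambda>_. d)"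
proof -
  have "\<beta> * p = of_int d + p"
    using assms(3) by (simp add: algebra_simps)
  moreover from this have "\<lceil>\<beta> * p\<rceil> = d + 1"
    using assms by (intro ceiling_unique) auto
  ultimately have p: "dbar \<beta> p 0 = d" "Tbar \<beta> p = p"
    by (simp_all add: Tbar_eq dbar_def)
  then have "(Tbar \<beta> ^^ n) p = p" for n
    by (induction n) auto
  then show ?thesis
    using p(1) dbar_funpow[of \<beta> _ p 0] by auto
qed

lemma fixed_point_of_constant_dbar:
  assumes "\<beta> > 1" "0 < x" "x \<le> 1" "dbar \<beta> x = (\<lambda>_. d)"
  shows "(\<beta> - 1) * x = of_int d"
proof -
  have "dbar \<beta> (Tbar \<beta> x) = dbar \<beta> x"
    using dbar_Suc[of \<beta> x] assms(4) by auto
  then have "Tbar \<beta> x = x"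
    using assms by (intro dbar_inj) (auto simp: Tbar_pos Tbar_le_1)
  then show ?thesis
    using assms(4) by (simp add: Tbar_eq algebra_simps)
qed

lemma lex_le_case_nat:
  assumes "lex_le u v"
  shows "lex_le (case_nat c u) (case_nat c v)"
proof (cases "u = v")
  case False
  then obtain k where "u k < v k" "\<forall>i<k. u i = v i"
    using assms by (auto simp: lex_le_def less_fun_def)
  then show ?thesis
    by (auto simp: lex_le_def less_fun_def split: nat.split intro!: exI[of _ "Suc k"])
qed (simp add: lex_le_def)

lemma case_nat_const: "case_nat d (\<lambda>_. d) = (\<lambda>_. d)"
  by (auto split: nat.split)

context beta_window
begin

text \<open>The images \<open>\<beta> * t\<close> and \<open>\<beta> * t + 1\<close> differ by an
  integer: the map identifies the ends of \<open>J\<close>, which closes the window to a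
  circle.\<close>

lemma right_end:
  "dbar \<beta> (t + 1 / \<beta>) 0 = a + 1" "Tbar \<beta> (t + 1 / \<beta>) = Tbar \<beta> t"
proof -
  have "\<beta> * (t + 1 / \<beta>) = \<beta> * t + 1"
    using beta by (simp add: field_simps)
  then show "dbar \<beta> (t + 1 / \<beta>) 0 = a + 1" "Tbar \<beta> (t + 1 / \<beta>) = Tbar \<beta> t"
    by (simp_all add: Tbar_eq dbar_def a_def)
qed

lemma dbar_right_end:
  assumes "dbar \<beta> t = case_nat a s"
  shows "dbar \<beta> (t + 1 / \<beta>) = case_nat (a + 1) s"
proof
  fix n
  show "dbar \<beta> (t + 1 / \<beta>) n = case_nat (a + 1) s n"
    using right_end assms dbar_Suc[of \<beta> t] by (cases n) (auto simp: dbar_Suc)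
qed

lemma digit_sum_right_end:
  assumes "n > 0"
  shows "digit_sum \<beta> (t + 1 / \<beta>) n = digit_sum \<beta> t n + 1"
proof -
  obtain m where m: "n = 1 + m" using assms by (metis Suc_pred plus_1_eq_Suc)
  have "dbar \<beta> t 0 = a" by (simp add: dbar_def a_def)
  then show ?thesis
    unfolding m digit_sum_add by (simp add: digit_sum_Suc right_end)
qed

lemma ends_in_J: "t \<in> J" "t + 1 / \<beta> \<in> J"
  using beta by auto

text \<open>The bounds are the digit sums of the two ends of \<open>J\<close>; they become
  lexicographic bounds and then order bounds on every iterate.\<close>

lemma stays_of_digit_sum:
  assumes x: "0 < x" "x \<le> 1"
    and "\<And>n m. m > 0 \<Longrightarrow> digit_sum \<beta> t m \<le> digit_sum \<beta> ((Tbar \<beta> ^^ n) x) m"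
    and "\<And>n m. m > 0 \<Longrightarrow> digit_sum \<beta> ((Tbar \<beta> ^^ n) x) m \<le> digit_sum \<beta> t m + 1"
  shows "stays x"
  unfolding stays_def
proof
  fix n
  let ?x = "(Tbar \<beta> ^^ n) x"
  have unit: "0 < ?x" "?x \<le> 1" using funpow_Tbar_range[OF x] by auto
  have ends: "0 < t" "t \<le> 1" "0 < t + 1 / \<beta>" "t + 1 / \<beta> \<le> 1"
    using J_unit ends_in_J by blast+
  have lower: "lex_le (dbar \<beta> t) (dbar \<beta> ?x)"
  proof (rule lex_le_of_partial_sums)
    fix m show "(\<Sum>i<m. dbar \<beta> t i) \<le> (\<Sum>i<m. dbar \<beta> ?x i)"
      using assms(3)[of m n] by (cases "m = 0") (auto simp: digit_sum_def)
  qed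
  have upper: "lex_le (dbar \<beta> ?x) (dbar \<beta> (t + 1 / \<beta>))"
  proof (rule lex_le_of_partial_sums)
    fix m show "(\<Sum>i<m. dbar \<beta> ?x i) \<le> (\<Sum>i<m. dbar \<beta> (t + 1 / \<beta>) i)"
      using assms(4)[of m n] digit_sum_right_end[of m] by (cases "m = 0") (auto simp: digit_sum_def)
  qed
  show "?x \<in> J"
    using dbar_le_imp_le[OF beta lower ends(1,2) unit] dbar_le_imp_le[OF beta upper unit ends(3,4)]
    by simp
qed

lemma mechanical_fixed_point:
  assumes "p \<in> J" "(\<beta> - 1) * p = of_int d"
  shows "mechanical_point \<beta> t a p (of_int d)"
proof
  show d: "dbar \<beta> p = upper_mechanical (of_int d)"
    using dbar_fixed_point assms J_unit by (simp add: upper_mechanical_of_int)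
  have "Tbar \<beta> p = p"
    using d assms(2) by (simp add: Tbar_eq upper_mechanical_of_int algebra_simps)
  then have "(Tbar \<beta> ^^ n) p = p" for n
    by (induction n) auto
  then show "stays p" using assms(1) by (simp add: stays_def)
qed

lemma a_less: "of_int a < \<beta> * t" "\<beta> * t \<le> of_int a + 1" "of_int a < \<beta> - 1"
proof -
  show *: "of_int a < \<beta> * t" "\<beta> * t \<le> of_int a + 1"
    using ceiling_correct[of "\<beta> * t"] by (auto simp: a_def)
  have "\<beta> * t + 1 \<le> \<beta>"
    using t_le beta by (simp add: field_simps)
  then show "of_int a < \<beta> - 1" using * by linarith
qed

lemma mechanical_low:
  assumes "dbar \<beta> t = case_nat a s" "\<And>n. s n \<ge> 0" "lex_le s (\<lambda>_. a)" "a \<ge> 0"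
  shows "mechanical_point \<beta> t a (of_int a / (\<beta> - 1)) (of_int a)"
proof -
  define p where "p = of_int a / (\<beta> - 1)"
  have fixed: "(\<beta> - 1) * p = of_int a" using beta by (simp add: p_def)
  have "lex_le (dbar \<beta> t) (\<lambda>_. a)"
    using lex_le_case_nat[OF assms(3), of a] by (simp add: assms(1) case_nat_const)
  \<comment> \<open>With \<open>a = 0\<close> the word \<open>s\<close> could only be zero, making
    \<open>t\<close> a fixed point with digit 0, that is \<open>t = 0\<close>. This ensures that the
    fixed point \<open>p\<close> is positive.\<close>
  have "a \<noteq> 0"
  proof
    assume [simp]: "a = 0"
    have "\<not> less_fun s (\<lambda>_. 0)"
      using assms(2) by (auto simp: less_fun_def not_less)
    then have "dbar \<beta> t = (\<lambda>_. 0)"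
      using assms(1,3) case_nat_const[of 0] by (simp add: lex_le_def)
    then show False
      using fixed_point_of_constant_dbar[OF beta, of t 0] J_unit ends_in_J beta t_pos by simp
  qed
  then have p: "0 < p" "p \<le> 1"
    using a_less beta assms(4) by (auto simp: p_def field_simps)
  have "t \<le> p"
    using \<open>lex_le (dbar \<beta> t) (\<lambda>_. a)\<close> dbar_le_imp_le[OF beta, of t p] p J_unit ends_in_J
      dbar_fixed_point[OF p fixed] by simp
  moreover have "\<beta> * p \<le> \<beta> * (t + 1 / \<beta>)"
    using fixed p a_less beta by (simp add: algebra_simps)
  then have "p \<le> t + 1 / \<beta>" using beta by simp
  ultimately show ?thesis
    using mechanical_fixed_point[OF _ fixed] by (simp add: p_def)
qed

lemma mechanical_high:
  assumes "dbar \<beta> t = case_nat a s" "\<And>n. s n \<le> \<lceil>\<beta>\<rceil> - 1" "lex_le (\<lambda>_. a + 1) s" "a \<ge> 0"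
  shows "mechanical_point \<beta> t a (of_int (a + 1) / (\<beta> - 1)) (of_int (a + 1))"
proof -
  define p where "p = of_int (a + 1) / (\<beta> - 1)"
  have fixed: "(\<beta> - 1) * p = of_int (a + 1)" using beta by (simp add: p_def)
  have "p > 0" using beta assms(4) by (simp add: p_def)
  have lex: "lex_le (\<lambda>_. a + 1) (dbar \<beta> (t + 1 / \<beta>))"
    using lex_le_case_nat[OF assms(3), of "a + 1"]
    by (simp add: dbar_right_end[OF assms(1)] case_nat_const)
  have "p \<le> t + 1 / \<beta>"
  proof (cases "p \<le> 1")
    case True
    then show ?thesis
      using lex dbar_le_imp_le[OF beta, of p "t + 1 / \<beta>"] \<open>p > 0\<close> J_unit ends_in_J
        dbar_fixed_point[OF _ _ fixed] by simp
  next
    \<comment> \<open>Now \<open>a + 1\<close> is the largest letter available, so \<open>s\<close>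
      is constant and the right end of \<open>J\<close> is itself the fixed point.\<close>
    case False
    then have "\<beta> - 1 < of_int (a + 1)" using beta by (simp add: p_def field_simps)
    then have "s n \<le> a + 1" for n
      using assms(2)[of n] by linarith
    then have "\<not> less_fun (\<lambda>_. a + 1) s"
      by (auto simp: less_fun_def not_less)
    then have "dbar \<beta> (t + 1 / \<beta>) = (\<lambda>_. a + 1)"
      using assms(3) dbar_right_end[OF assms(1)] case_nat_const[of "a + 1"]
      by (auto simp: lex_le_def)
    then have "(\<beta> - 1) * (t + 1 / \<beta>) = of_int (a + 1)"
      using J_unit ends_in_J by (intro fixed_point_of_constant_dbar[OF beta]) blast+
    then show ?thesis
      using fixed beta by (metis diff_gt_0_iff_gt less_irrefl mult_left_cancel order_refl)
  qed
  moreover have "\<beta> * t \<le> \<beta> * p"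
    using fixed a_less \<open>p > 0\<close> by (simp add: algebra_simps)
  then have "t \<le> p" using beta by simp
  ultimately show ?thesis
    using mechanical_fixed_point[OF _ fixed] by (simp add: p_def)
qed

text \<open>Orbit digit sums have the form \<open>\<lceil>u + v\<rceil> - \<lceil>u\<rceil>\<close>,
  which is \<open>\<lceil>v\<rceil>\<close> or one less: exactly the sums of the two ends.\<close>

lemma mechanical_right_end:
  assumes "dbar \<beta> (t + 1 / \<beta>) = upper_mechanical \<alpha>"
  shows "mechanical_point \<beta> t a (t + 1 / \<beta>) \<alpha>"
proof
  let ?y = "t + 1 / \<beta>"
  have y: "digit_sum \<beta> ?y m = \<lceil>\<alpha> * real m\<rceil>" for m
    by (simp add: digit_sum_def assms sum_upper_mechanical)
  then have orb: "digit_sum \<beta> ((Tbar \<beta> ^^ n) ?y) m = \<lceil>\<alpha> * real n + \<alpha> * real m\<rceil> - \<lceil>\<alpha> * real n\<rceil>" for n m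
    using digit_sum_add[of \<beta> ?y n m] by (simp add: distrib_left)
  have t: "digit_sum \<beta> t m = \<lceil>\<alpha> * real m\<rceil> - 1" if "m > 0" for m
    using digit_sum_right_end[OF that] y by simp
  show "stays ?y"
  proof (rule stays_of_digit_sum)
    show "0 < ?y" "?y \<le> 1" using J_unit ends_in_J by blast+
    fix n m :: nat assume "m > 0"
    show "digit_sum \<beta> t m \<le> digit_sum \<beta> ((Tbar \<beta> ^^ n) ?y) m"
      "digit_sum \<beta> ((Tbar \<beta> ^^ n) ?y) m \<le> digit_sum \<beta> t m + 1"
      unfolding t[OF \<open>m > 0\<close>] orb by linarith+
  qed
qed (fact assms)

text \<open>For rational slope \<open>t\<close> stays and a suitable iterate has the upper word. For
  irrational slope floor and ceiling differ by one at every positive length, so the right end has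
  the upper word.\<close>

lemma mechanical_left_end:
  assumes "dbar \<beta> t = lower_mechanical \<alpha>"
  shows "\<exists>y. mechanical_point \<beta> t a y \<alpha>"
proof -
  have t: "digit_sum \<beta> t m = \<lfloor>\<alpha> * real m\<rfloor>" for m
    by (simp add: digit_sum_def assms sum_lower_mechanical)
  have upperI: "dbar \<beta> x = upper_mechanical \<alpha>" if "\<And>m. digit_sum \<beta> x m = \<lceil>\<alpha> * real m\<rceil>" for x
  proof
    fix i show "dbar \<beta> x i = upper_mechanical \<alpha> i"
      using that[of i] that[of "Suc i"] by (simp add: digit_sum_Suc upper_mechanical_def add.commute)
  qed
  show ?thesis
  proof (cases "\<alpha> \<in> \<rat>")
    case True
    then obtain k where k: "\<And>n. \<lfloor>\<alpha> * real (k + n)\<rfloor> - \<lfloor>\<alpha> * real k\<rfloor> = \<lceil>\<alpha> * real n\<rceil>"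
      using upper_mechanical_is_shift_of_lower by blast
    have orb: "digit_sum \<beta> ((Tbar \<beta> ^^ n) t) m = \<lfloor>\<alpha> * real n + \<alpha> * real m\<rfloor> - \<lfloor>\<alpha> * real n\<rfloor>" for n m
      using digit_sum_add[of \<beta> t n m] t by (simp add: distrib_left)
    have "stays t"
    proof (rule stays_of_digit_sum)
      show "0 < t" "t \<le> 1" using J_unit ends_in_J by blast+
      fix n m :: nat
      show "digit_sum \<beta> t m \<le> digit_sum \<beta> ((Tbar \<beta> ^^ n) t) m"
        "digit_sum \<beta> ((Tbar \<beta> ^^ n) t) m \<le> digit_sum \<beta> t m + 1"
        unfolding t orb by linarith+
    qed
    then have "mechanical_point \<beta> t a ((Tbar \<beta> ^^ k) t) \<alpha>"
      using k orb by unfold_locales (auto simp: distrib_left intro: stays_funpow upperI)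
    then show ?thesis by blast
  next
    case False
    have "dbar \<beta> (t + 1 / \<beta>) = upper_mechanical \<alpha>"
    proof (rule upperI)
      fix m
      show "digit_sum \<beta> (t + 1 / \<beta>) m = \<lceil>\<alpha> * real m\<rceil>"
      proof (cases "m = 0")
        case m: False
        then have "\<lceil>\<alpha> * real m\<rceil> = \<lfloor>\<alpha> * real m\<rfloor> + 1"
          using irrational_multiple_not_int[OF False, of m] by (metis Ints_of_int ceiling_altdef neq0_conv)
        then show ?thesis using m digit_sum_right_end t by simp
      qed simp
    qed
    then show ?thesis using mechanical_right_end by blast
  qed
qed

end

section \<open>The three cases of the theorem\<close>

theorem theorem4p7:
  fixes \<beta> t :: real and a b :: int and s :: "nat \<Rightarrow> int" and J :: "real set"
  assumes "\<beta> > 1"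
    and "0 \<le> t" and "t \<le> 1 - 1 / \<beta>"
    and "a \<in> alphabet \<beta>" and "\<forall>n. s n \<in> alphabet \<beta>"
    and "dbar \<beta> t = case_nat a s"
    and "b = a + 1"
    and "J = {t..t + 1 / \<beta>}"
  shows
    "(lex_le s (\<lambda>_. a) \<longrightarrow>
       (let S = orbit_closure \<beta> (word_value \<beta> (\<lambda>_. a)) in
          S \<subseteq> J \<and> Tbar_invariant \<beta> S \<and>
          unique_invariant_orbit_closure_in \<beta> J S \<and>
          set_has_frequency \<beta> S (real_of_int a))) \<and>
     (lex_le (\<lambda>_. b) s \<longrightarrow>
       (let S = orbit_closure \<beta> (word_value \<beta> (\<lambda>_. b)) in
          S \<subseteq> J \<and> Tbar_invariant \<beta> S \<and>
          unique_invariant_orbit_closure_in \<beta> J S \<and>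
          set_has_frequency \<beta> S (real_of_int b))) \<and>
     (\<forall>\<alpha>\<in>{real_of_int a..real_of_int b}.
        case_nat a s = lower_mechanical \<alpha> \<or> case_nat b s = upper_mechanical \<alpha> \<longrightarrow>
       (let S = orbit_closure \<beta> (word_value \<beta> (upper_mechanical \<alpha>)) in
          S \<subseteq> J \<and> Tbar_invariant \<beta> S \<and>
          unique_invariant_orbit_closure_in \<beta> J S \<and>
          set_has_frequency \<beta> S \<alpha>))"
proof -
  have digit: "\<lceil>\<beta> * t\<rceil> - 1 = a"
    using fun_cong[OF assms(6), of 0] by (simp add: dbar_def)
  have "a \<ge> 0" and s: "s n \<ge> 0" "s n \<le> \<lceil>\<beta>\<rceil> - 1" for n
    using assms(4,5) by (auto simp: alphabet_def)
  \<comment> \<open>The value \<open>t = 0\<close> is excluded since its first digit would be \<open>-1\<close>.\<close>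
  have "t \<noteq> 0"
    using digit \<open>a \<ge> 0\<close> by auto
  then interpret beta_window \<beta> t a
    using assms(1-3) digit by unfold_locales auto
  have goal: "let S = orbit_closure \<beta> (word_value \<beta> (upper_mechanical \<alpha>)) in
      S \<subseteq> J \<and> Tbar_invariant \<beta> S \<and>
      unique_invariant_orbit_closure_in \<beta> J S \<and> set_has_frequency \<beta> S \<alpha>"
    if "mechanical_point \<beta> t a y \<alpha>" for y \<alpha>
    using mechanical_point.mechanical_orbit_closure[OF that] assms(8) by (simp add: Let_def)
  \<comment> \<open>Rewriting with \<open>upper_mechanical_of_int\<close> turns the constant words
    of the first two cases into integer slopes; the third uses the left or the right end of
    \<open>J\<close>.\<close>
  show ?thesis
    using goal[OF mechanical_low[OF assms(6) s(1) _ \<open>a \<ge> 0\<close>]]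
      goal[OF mechanical_high[OF assms(6) s(2) _ \<open>a \<ge> 0\<close>]]
      mechanical_left_end mechanical_right_end goal
      dbar_right_end[OF assms(6)] assms(6,7)
    unfolding upper_mechanical_of_int by metis
qed

end
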